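(* Let $(M_1,\mathrm{dist}_1)$ and $(M_2,\mathrm{dist}_2)$ be compact metric spaces, $\phi_1$ a topological flow on $M_1$ and $\phi_2$ a topological flow on $M_2$. Suppose $\phi_1$ has the oriented shadowing property and $\mathrm{Sing}(\phi_1)$ is finite. Suppose the limit set $L(\phi_2)$ is a finite set consisting of singularities of $\phi_2$, each of which is Lyapunov stable or Lyapunov unstable. Then the product flow $\phi_1\times\phi_2$ on $M_1\times M_2$, $(\phi_1\times\phi_2)(t,(x_1,x_2))=(\phi_1(t,x_1),\phi_2(t,x_2))$, has the oriented shadowing property (with respect to the metric $\mathrm{dist}((x_1,x_2),(y_1,y_2))=\max\{\mathrm{dist}_1(x_1,y_1),\mathrm{dist}_2(x_2,y_2)\}$).
   Context: A topological flow on a compact metric space $M$ is a continuous map $\phi:\mathbb{R}\times M\to M$ with $\phi(0,x)=x$ and $\phi(s+t,x)=\phi(s,\phi(t,x))$. $\mathrm{Sing}(\phi)=\{x: \phi(t,x)=x\ \forall t\}$. A singularity $p$ is Lyapunov stable if for every neighborhood $V$ of $p$ there is a neighborhood $U$ of $p$ with $\phi(t,x)\in V$ for all $t\ge0$, $x\in U$; Lyapunov unstable if the same holds for $t\le 0$. The limit set $L(\phi)$ is the union over $x\in M$ of the $\omega$-limit and $\alpha$-limit sets of $x$. A $d$-pseudotrajectory is a map $\xi:\mathbb{R}\to M$ with $\mathrm{dist}(\xi(t+s),\phi(s,\xi(t)))<d$ for all $t\in\mathbb{R}$, $s\in[0,1]$. $\mathrm{Rep}$ is the set of orientation-preserving homeomorphisms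 of $\mathbb{R}$. $\phi$ has the oriented shadowing property if for every $\varepsilon>0$ there is $d>0$ such that for every $d$-pseudotrajectory $\xi$ there are $x\in M$ and $h\in\mathrm{Rep}$ with $\mathrm{dist}(\xi(t),\phi(h(t),x))<\varepsilon$ for all $t\in\mathbb{R}$. *)

theory Defs
  imports "HOL-Analysis.Analysis"
begin

definition is_flow :: "'a::topological_space set \<Rightarrow> (real \<Rightarrow> 'a \<Rightarrow> 'a) \<Rightarrow> bool" where
  "is_flow M phi \<longleftrightarrow>
     continuous_on (UNIV \<times> M) (\<lambda>(t, x). phi t x) \<and>
     (\<forall>t. \<forall>x\<in>M. phi t x \<in> M) \<and>
     (\<forall>x\<in>M. phi 0 x = x) \<and>
     (\<forall>s t. \<forall>x\<in>M. phi (s + t) x = phi s (phi t x))"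

definition Sing :: "'a set \<Rightarrow> (real \<Rightarrow> 'a \<Rightarrow> 'a) \<Rightarrow> 'a set" where
  "Sing M phi = {x \<in> M. \<forall>t. phi t x = x}"

definition lyap_stable :: "'a::topological_space set \<Rightarrow> (real \<Rightarrow> 'a \<Rightarrow> 'a) \<Rightarrow> 'a \<Rightarrow> bool" where
  "lyap_stable M phi p \<longleftrightarrow>
     (\<forall>V. open V \<and> p \<in> V \<longrightarrow>
        (\<exists>U. open U \<and> p \<in> U \<and> (\<forall>t\<ge>0. \<forall>x\<in>U \<inter> M. phi t x \<in> V)))"

definition lyap_unstable :: "'a::topological_space set \<Rightarrow> (real \<Rightarrow> 'a \<Rightarrow> 'a) \<Rightarrow> 'a \<Rightarrow> bool" where
  "lyap_unstable M phi p \<longleftrightarrow>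
     (\<forall>V. open V \<and> p \<in> V \<longrightarrow>
        (\<exists>U. open U \<and> p \<in> U \<and> (\<forall>t\<le>0. \<forall>x\<in>U \<inter> M. phi t x \<in> V)))"

definition omega_limit :: "(real \<Rightarrow> 'a::topological_space \<Rightarrow> 'a) \<Rightarrow> 'a \<Rightarrow> 'a set" where
  "omega_limit phi x = {y. \<exists>s::nat \<Rightarrow> real. filterlim s at_top sequentially \<and>
                               (\<lambda>n. phi (s n) x) \<longlonglongrightarrow> y}"

definition alpha_limit :: "(real \<Rightarrow> 'a::topological_space \<Rightarrow> 'a) \<Rightarrow> 'a \<Rightarrow> 'a set" where
  "alpha_limit phi x = {y. \<exists>s::nat \<Rightarrow> real. filterlim s at_bot sequentially \<and>
                               (\<lambda>n. phi (s n) x) \<longlonglongrightarrow> y}"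

definition limit_set :: "'a::topological_space set \<Rightarrow> (real \<Rightarrow> 'a \<Rightarrow> 'a) \<Rightarrow> 'a set" where
  "limit_set M phi = (\<Union>x\<in>M. omega_limit phi x \<union> alpha_limit phi x)"

definition Rep :: "(real \<Rightarrow> real) set" where
  "Rep = {h. (\<exists>g. homeomorphism UNIV UNIV h g) \<and> strict_mono h}"

definition pseudotrajectory ::
    "('a \<Rightarrow> 'a \<Rightarrow> real) \<Rightarrow> 'a set \<Rightarrow> (real \<Rightarrow> 'a \<Rightarrow> 'a) \<Rightarrow> real \<Rightarrow> (real \<Rightarrow> 'a) \<Rightarrow> bool" where
  "pseudotrajectory d M phi \<delta> \<xi> \<longleftrightarrow>
     (\<forall>t. \<xi> t \<in> M) \<and> (\<forall>t. \<forall>s\<in>{0..1}. d (\<xi> (t + s)) (phi s (\<xi> t)) < \<delta>)"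

definition oriented_shadowing ::
    "('a \<Rightarrow> 'a \<Rightarrow> real) \<Rightarrow> 'a set \<Rightarrow> (real \<Rightarrow> 'a \<Rightarrow> 'a) \<Rightarrow> bool" where
  "oriented_shadowing d M phi \<longleftrightarrow>
     (\<forall>\<epsilon>>0. \<exists>\<delta>>0. \<forall>\<xi>. pseudotrajectory d M phi \<delta> \<xi> \<longrightarrow>
        (\<exists>x\<in>M. \<exists>h\<in>Rep. \<forall>t. d (\<xi> t) (phi (h t) x) < \<epsilon>))"

definition prod_flow :: "(real \<Rightarrow> 'a \<Rightarrow> 'a) \<Rightarrow> (real \<Rightarrow> 'b \<Rightarrow> 'b) \<Rightarrow> real \<Rightarrow> 'a \<times> 'b \<Rightarrow> 'a \<times> 'b" where
  "prod_flow phi1 phi2 t = (\<lambda>(x1, x2). (phi1 t x1, phi2 t x2))"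

definition max_dist :: "'a::metric_space \<times> 'b::metric_space \<Rightarrow> 'a \<times> 'b \<Rightarrow> real" where
  "max_dist = (\<lambda>(x1, x2) (y1, y2). max (dist x1 y1) (dist x2 y2))"

end

theory Submission
  imports Defs
begin

text \<open>
  Because every point of the finite set \<open>L(\<phi>\<^sub>2)\<close> is stable or unstable, a fine pseudotrajectory of \<open>\<phi>\<^sub>2\<close>
  either stays near one singularity for all time, or it stays near an unstable one up to some time \<open>a\<close>
  and near a stable one from \<open>a + T\<close> on, where \<open>T\<close> depends only on the accuracy. The orbit of its value
  at time \<open>a\<close> therefore shadows it under every reparametrization \<open>h\<close> with \<open>h a = 0\<close> that moves at
  almost unit speed on \<open>[a, a + T]\<close>. A reparametrization that shadows in \<open>M\<^sub>1\<close> can be arranged to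
  do so: if the orbit is away from \<open>Sing(\<phi>\<^sub>1)\<close> at time \<open>a\<close>, unit speed is forced, since
  points away from the singularities have no arbitrarily small periods; otherwise the whole window is
  spent near a singularity and \<open>h\<close> may be changed freely there.
\<close>

section \<open>Reparametrizations of the real line\<close>

lemma RepI:
  assumes "strict_mono h" "continuous_on UNIV h" "surj h"
  shows "h \<in> Rep"
proof -
  have inj: "inj h" using assms(1) by (simp add: strict_mono_imp_inj_on)
  \<comment> \<open>A continuous injection of the path-connected line is a homeomorphism onto its
    image, so continuity of the inverse is automatic.\<close>
  have "\<exists>g. homeomorphism UNIV (h ` UNIV) h g"
    using injective_into_1d_eq_homeomorphism[of UNIV h] inj assms(2) by (auto simp: path_connected_UNIV)
  then show ?thesis using assms by (auto simp: Rep_def)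
qed

lemma RepD:
  assumes "h \<in> Rep"
  shows "strict_mono h" "continuous_on UNIV h" "surj h"
  using assms by (auto simp: Rep_def homeomorphism_def)

lemma Rep_shift:
  assumes "h \<in> Rep"
  shows "(\<lambda>t. h t - c) \<in> Rep"
proof (rule RepI)
  show "strict_mono (\<lambda>t. h t - c)" using RepD(1)[OF assms] by (simp add: strict_mono_def)
  show "continuous_on UNIV (\<lambda>t. h t - c)" using RepD(2)[OF assms] by (intro continuous_intros)
  show "surj (\<lambda>t. h t - c)"
    unfolding surj_def by (metis RepD(3)[OF assms] surjD add_diff_cancel)
qed

text \<open>Used to change the speed of a shadowing orbit on a compact time interval without
  touching \<open>h\<close> elsewhere. Agreement at both ends keeps the glued map continuous and
  increasing.\<close>

lemma Rep_glue:
  assumes h: "h \<in> Rep" and "a \<le> b"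
    and g: "strict_mono_on {a..b} g" "continuous_on {a..b} g" "g a = h a" "g b = h b"
  shows "(\<lambda>t. if t \<in> {a..b} then g t else h t) \<in> Rep"
proof (rule RepI)
  let ?k = "\<lambda>t. if t \<in> {a..b} then g t else h t"
  note sm = RepD(1)[OF h]
  have gm: "g s < g t" if "a \<le> s" "s < t" "t \<le> b" for s t
    using g(1) that by (auto simp: strict_mono_on_def)
  \<comment> \<open>The values of \<open>g\<close> stay between \<open>h a\<close> and
    \<open>h b\<close>, which settles the comparison of a time inside \<open>{a..b}\<close> with one
    outside.\<close>
  have lo: "h a \<le> g t" and hi: "g t \<le> h b" if "t \<in> {a..b}" for t
    using that gm[of a t] gm[of t b] g(3,4) by (cases "t = a"; cases "t = b"; force)+
  show "strict_mono ?k"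
  proof (rule strict_monoI)
    fix s t :: real
    assume st: "s < t"
    have hm: "h s < h t" if "s < t" for s t using sm that by (simp add: strict_mono_def)
    consider "s < a" "t < a" | "s < a" "t \<in> {a..b}" | "s < a" "t > b" | "s \<in> {a..b}" "t \<in> {a..b}"
      | "s \<in> {a..b}" "t > b" | "s > b" "t > b"
      using st \<open>a \<le> b\<close> by fastforce
    then show "?k s < ?k t"
    proof cases
      case 2 then show ?thesis using hm[of s a] lo[of t] by auto
    next
      case 5 then show ?thesis using hm[of b t] hi[of s] by auto
    qed (use st hm gm in auto)
  qed
  have "continuous_on ({..a} \<union> ({a..b} \<union> {b..})) ?k"
  proof (intro continuous_on_closed_Un)
    have hc: "continuous_on A h" for A using RepD(2)[OF h] continuous_on_subset by blast
    show "continuous_on {..a} ?k"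
      by (rule continuous_on_eq[OF hc]) (use g \<open>a \<le> b\<close> in auto)
    show "continuous_on {a..b} ?k"
      by (rule continuous_on_eq[OF g(2)]) auto
    show "continuous_on {b..} ?k"
      by (rule continuous_on_eq[OF hc]) (use g \<open>a \<le> b\<close> in auto)
  qed auto
  moreover have "{..a} \<union> ({a..b} \<union> {b..}) = UNIV" using \<open>a \<le> b\<close> by auto
  ultimately show "continuous_on UNIV ?k" by simp
  then have cont: "continuous_on {s..t} ?k" for s t using continuous_on_subset by blast
  show "surj ?k"
    unfolding surj_def
  proof
    fix y
    obtain u where u: "h u = y" using RepD(3)[OF h] surjD by metis
    show "\<exists>x. y = ?k x"
    proof (cases "u \<in> {a..b}")
      case False then show ?thesis using u by auto
    next
      case True
      then have "h a \<le> y" "y \<le> h b" using sm u by (auto simp: strict_mono_less_eq)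
      then have "\<exists>x\<ge>a. x \<le> b \<and> ?k x = y"
        by (intro IVT' cont) (use g \<open>a \<le> b\<close> in auto)
      then show ?thesis by metis
    qed
  qed
qed

text \<open>Pigeonhole: if each of the finitely many \<open>p\<close> failed from some time on, all
  would fail together from the latest of these times on.\<close>

lemma frequently_at_top_finite:
  fixes P :: "real \<Rightarrow> 'a \<Rightarrow> bool"
  assumes "finite S" "\<And>t. \<exists>u\<ge>t. \<exists>p\<in>S. P u p"
  shows "\<exists>p\<in>S. \<forall>t. \<exists>u\<ge>t. P u p"
proof (rule ccontr)
  assume "\<not> ?thesis"
  then have "\<forall>p\<in>S. \<forall>\<^sub>F u in at_top. \<not> P u p" by (auto simp: eventually_at_top_linorder)
  then have "\<forall>\<^sub>F u in at_top. \<forall>p\<in>S. \<not> P u p" using assms(1) by (simp add: eventually_ball_finite)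
  then show False using assms(2) unfolding eventually_at_top_linorder by blast
qed

section \<open>Flows on compact sets and estimates over bounded times\<close>

locale compact_flow =
  fixes M :: "'a::metric_space set" and phi :: "real \<Rightarrow> 'a \<Rightarrow> 'a"
  assumes compact: "compact M" and flow: "is_flow M phi"
begin

lemma cont: "continuous_on (UNIV \<times> M) (\<lambda>(t, x). phi t x)"
  and in_M [simp, intro]: "x \<in> M \<Longrightarrow> phi t x \<in> M"
  and flow_0 [simp]: "x \<in> M \<Longrightarrow> phi 0 x = x"
  and flow_add: "x \<in> M \<Longrightarrow> phi (s + t) x = phi s (phi t x)"
  using flow by (auto simp: is_flow_def)

lemma flow_uniformly_continuous:
  assumes "\<epsilon> > 0"
  obtains \<delta> where "\<delta> > 0"
    "\<And>s t x y. \<lbrakk>\<bar>s\<bar> \<le> K; \<bar>t\<bar> \<le> K; x \<in> M; y \<in> M; \<bar>s - t\<bar> < \<delta>; dist x y < \<delta>\<rbrakk>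
       \<Longrightarrow> dist (phi s x) (phi t y) < \<epsilon>"
proof -
  have "uniformly_continuous_on ({-K..K} \<times> M) (\<lambda>(t, x). phi t x)"
    by (rule compact_uniformly_continuous)
       (auto intro: continuous_on_subset[OF cont] compact_Times compact)
  then obtain d where d: "d > 0"
    "\<And>p q. \<lbrakk>p \<in> {-K..K} \<times> M; q \<in> {-K..K} \<times> M; dist q p < d\<rbrakk>
       \<Longrightarrow> dist (case q of (t, x) \<Rightarrow> phi t x) (case p of (t, x) \<Rightarrow> phi t x) < \<epsilon>"
    unfolding uniformly_continuous_on_def using assms by metis
  show thesis
  proof (rule that[of "d/2"])
    fix s t x y
    assume a: "\<bar>s\<bar> \<le> K" "\<bar>t\<bar> \<le> K" "x \<in> M" "y \<in> M" "\<bar>s - t\<bar> < d/2" "dist x y < d/2"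
    have "dist (s, x) (t, y) \<le> dist s t + dist x y"
      by (simp add: dist_Pair_Pair sqrt_sum_squares_le_sum)
    also have "\<dots> < d" using a by (simp add: dist_real_def)
    finally show "dist (phi s x) (phi t y) < \<epsilon>" using d(2)[of "(t, y)" "(s, x)"] a by (auto simp: abs_le_iff)
  qed (use d in auto)
qed

lemma flow_tendsto:
  assumes "s \<longlonglongrightarrow> t" "x \<longlonglongrightarrow> y" "\<And>n. x n \<in> M" "y \<in> M"
  shows "(\<lambda>n. phi (s n) (x n)) \<longlonglongrightarrow> phi t y"
  using continuous_on_tendsto_compose[OF cont, of "\<lambda>n. (s n, x n)" "(t, y)" sequentially] assms
  by (auto intro: tendsto_Pair)

lemma pseudotrajectory_mono:
  assumes "pseudotrajectory dist M phi \<delta> \<xi>" "\<delta> \<le> \<delta>'"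
  shows "pseudotrajectory dist M phi \<delta>' \<xi>"
  using assms unfolding pseudotrajectory_def by (meson less_le_trans)

lemma orbit_pseudotrajectory:
  assumes "x \<in> M" "\<delta> > 0"
  shows "pseudotrajectory dist M phi \<delta> (\<lambda>t. phi t x)"
  using assms by (auto simp: pseudotrajectory_def add.commute simp flip: flow_add)

text \<open>The definition controls steps of length at most 1. Induction on the number of unit steps
  extends this to \<open>{0..T}\<close>: uniform continuity carries the error of the first step
  along, the induction hypothesis covers the remaining time, and each takes half of
  \<open>\<epsilon>\<close>.\<close>

lemma pseudotrajectory_near_orbit:
  assumes "\<epsilon> > 0"
  obtains \<delta> where "\<delta> > 0"
    "\<And>\<xi> t s. \<lbrakk>pseudotrajectory dist M phi \<delta> \<xi>; s \<in> {0..T}\<rbrakk> \<Longrightarrow> dist (\<xi> (t + s)) (phi s (\<xi> t)) < \<epsilon>"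
proof -
  have "\<exists>\<delta>>0. \<forall>\<xi> t. \<forall>s\<in>{0..real n}. pseudotrajectory dist M phi \<delta> \<xi> \<longrightarrow>
           dist (\<xi> (t + s)) (phi s (\<xi> t)) < \<epsilon>" if "\<epsilon> > 0" for n \<epsilon>
    using that
  proof (induction n arbitrary: \<epsilon>)
    case 0
    then show ?case by (auto simp: pseudotrajectory_def intro!: exI[of _ 1])
  next
    case (Suc n)
    obtain d where d: "d > 0"
      "\<And>\<xi> t s. \<lbrakk>s \<in> {0..real n}; pseudotrajectory dist M phi d \<xi>\<rbrakk>
         \<Longrightarrow> dist (\<xi> (t + s)) (phi s (\<xi> t)) < \<epsilon>/2"
      using Suc.IH[of "\<epsilon>/2"] Suc.prems by fastforce
    obtain e where e: "e > 0"
      "\<And>s t x y. \<lbrakk>\<bar>s\<bar> \<le> real n; \<bar>t\<bar> \<le> real n; x \<in> M; y \<in> M; \<bar>s - t\<bar> < e; dist x y < e\<rbrakk>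
       \<Longrightarrow> dist (phi s x) (phi t y) < \<epsilon>/2"
      using flow_uniformly_continuous[OF half_gt_zero[OF Suc.prems], of "real n"] by blast
    \<comment> \<open>\<open>d\<close> serves the remaining \<open>n\<close> units of time,
      \<open>e\<close> the transport of the first error, and \<open>\<epsilon>\<close> the case
      \<open>s \<le> 1\<close>.\<close>
    define D where "D = min (min d e) \<epsilon>"
    have "dist (\<xi> (t + s)) (phi s (\<xi> t)) < \<epsilon>"
      if s: "s \<in> {0..real (Suc n)}" and p: "pseudotrajectory dist M phi D \<xi>" for \<xi> t s
    proof (cases "s \<le> 1")
      case True
      then show ?thesis using p s by (auto simp: pseudotrajectory_def D_def)
    next
      case False
      define u where "u = s - 1"
      have u: "u \<in> {0..real n}" using False s by (auto simp: u_def)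
      have pd: "pseudotrajectory dist M phi d \<xi>" using p by (auto simp: pseudotrajectory_def D_def)
      have M: "\<xi> t \<in> M" for t using p by (simp add: pseudotrajectory_def)
      have "dist (\<xi> (t + 1)) (phi 1 (\<xi> t)) < e" using p by (auto simp: pseudotrajectory_def D_def)
      then have "dist (phi u (\<xi> (t + 1))) (phi u (phi 1 (\<xi> t))) < \<epsilon>/2"
        using e u M by auto
      moreover have "dist (\<xi> (t + 1 + u)) (phi u (\<xi> (t + 1))) < \<epsilon>/2" using d(2) u pd by auto
      moreover have "t + 1 + u = t + s" "phi u (phi 1 (\<xi> t)) = phi s (\<xi> t)"
        using M by (auto simp: u_def flow_add[symmetric])
      ultimately show ?thesis by (metis dist_triangle_half_r dist_commute)
    qed
    moreover have "D > 0" using d e Suc.prems by (auto simp: D_def)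
    ultimately show ?case by blast
  qed
  from this[OF assms, of "nat \<lceil>T\<rceil>"] obtain d where d: "d > 0"
    "\<And>\<xi> t s. \<lbrakk>s \<in> {0..real (nat \<lceil>T\<rceil>)}; pseudotrajectory dist M phi d \<xi>\<rbrakk>
         \<Longrightarrow> dist (\<xi> (t + s)) (phi s (\<xi> t)) < \<epsilon>" by blast
  have "s \<in> {0..real (nat \<lceil>T\<rceil>)}" if "s \<in> {0..T}" for s
    using that order_trans[OF _ real_nat_ceiling_ge[of T], of s] unfolding atLeastAtMost_iff by blast
  then show thesis using that[of d] d by blast
qed

text \<open>Reversal of time exchanges stable with unstable points and \<omega>-limits with
  \<alpha>-limits, so results for stable points carry over to unstable ones.\<close>

lemma compact_flow_reverse: "compact_flow M (\<lambda>t. phi (- t))"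
proof
  have "continuous_on (UNIV \<times> M) ((\<lambda>(t, x). phi t x) \<circ> (\<lambda>(t, x). (- t, x)))"
    by (rule continuous_on_compose)
       (auto simp: case_prod_unfold intro!: continuous_intros continuous_on_subset[OF cont[unfolded case_prod_unfold]])
  moreover have "(\<lambda>(t, x). phi t x) \<circ> (\<lambda>(t, x). (- t, x)) = (\<lambda>(t, x). phi (- t) x)" by auto
  moreover have "phi (- s - t) x = phi (- s) (phi (- t) x)" if "x \<in> M" for s t x
    using flow_add[OF that, of "-s" "-t"] by simp
  ultimately show "is_flow M (\<lambda>t. phi (- t))" by (auto simp: is_flow_def)
qed (rule compact)

text \<open>Controlled forward steps give controlled backward steps: the error of a forward step is
  carried back over a time at most 1, where uniform continuity bounds it. The two accuracies differ
  for this reason.\<close>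

lemma pseudotrajectory_reverse:
  assumes "\<epsilon> > 0"
  obtains \<delta> where "\<delta> > 0"
    "\<And>\<xi>. pseudotrajectory dist M phi \<delta> \<xi> \<Longrightarrow>
       pseudotrajectory dist M (\<lambda>t. phi (- t)) \<epsilon> (\<lambda>t. \<xi> (- t))"
proof -
  obtain e where e: "e > 0"
      "\<And>s t x y. \<lbrakk>\<bar>s\<bar> \<le> 1; \<bar>t\<bar> \<le> 1; x \<in> M; y \<in> M; \<bar>s - t\<bar> < e; dist x y < e\<rbrakk>
       \<Longrightarrow> dist (phi s x) (phi t y) < \<epsilon>"
    using flow_uniformly_continuous[of "\<epsilon>" 1] assms by auto
  show thesis
  proof (rule that[of e])
    fix \<xi> assume p: "pseudotrajectory dist M phi e \<xi>"
    then have M: "\<xi> t \<in> M" for t by (simp add: pseudotrajectory_def)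
    show "pseudotrajectory dist M (\<lambda>t. phi (- t)) \<epsilon> (\<lambda>t. \<xi> (- t))"
      unfolding pseudotrajectory_def
    proof (intro conjI allI ballI M)
      fix t s :: real assume s: "s \<in> {0..1}"
      have "dist (\<xi> (- t)) (phi s (\<xi> (- t - s))) < e"
        using p s diff_add_cancel[of "- t" s] unfolding pseudotrajectory_def by metis
      then have "dist (phi (- s) (\<xi> (- t))) (phi (- s) (phi s (\<xi> (- t - s)))) < \<epsilon>"
        using e s M by auto
      then show "dist (\<xi> (- (t + s))) (phi (- s) (\<xi> (- t))) < \<epsilon>"
        using M by (simp add: flow_add[symmetric] dist_commute)
    qed
  qed (use e in auto)
qed

section \<open>Limit sets and pseudotrajectories near stable or unstable singularities\<close>

lemma omega_limit_inter:
  assumes "x \<in> M" "closed C" "\<And>t. t \<ge> 0 \<Longrightarrow> phi t x \<in> C"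
  obtains y where "y \<in> omega_limit phi x" "y \<in> C"
proof -
  have "\<forall>n. phi (real n) x \<in> M" using assms by auto
  then obtain y r where y: "y \<in> M" "strict_mono (r :: nat \<Rightarrow> nat)" "(\<lambda>n. phi (real (r n)) x) \<longlonglongrightarrow> y"
    using seq_compactE[OF compact[THEN compact_imp_seq_compact], of "\<lambda>n. phi (real n) x"]
    by (auto simp: o_def)
  have "filterlim (\<lambda>n. real (r n)) at_top sequentially"
    using filterlim_compose[OF filterlim_real_sequentially filterlim_subseq[OF y(2)]] .
  then have "y \<in> omega_limit phi x" using y unfolding omega_limit_def by (intro CollectI exI[of _ "\<lambda>n. real (r n)"]) auto
  moreover have "y \<in> C" using Lim_in_closed_set[OF assms(2) _ _ y(3)] assms(3) by auto
  ultimately show thesis using that by blast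
qed

text \<open>Stability alone does not keep small errors from accumulating. Here \<open>q\<close> is
  isolated from the rest of the finite set \<open>F\<close> that carries all \<omega>-limits, so
  orbits starting near \<open>q\<close> are attracted to it. Compactness makes this uniform: one
  time \<open>T\<close> carries the \<open>r\<close>-ball into the \<open>r/2\<close>-ball, and this
  contraction absorbs the error made in each stretch of length \<open>T\<close>.\<close>

lemma trapping:
  assumes q: "lyap_stable M phi q" and fin: "finite F"
    and F: "\<And>x. x \<in> M \<Longrightarrow> omega_limit phi x \<subseteq> F" and "\<epsilon> > 0"
  obtains r where "r > 0"
    "\<And>\<xi> s t. \<lbrakk>pseudotrajectory dist M phi r \<xi>; dist q (\<xi> s) < r; s \<le> t\<rbrakk> \<Longrightarrow> dist q (\<xi> t) < \<epsilon>"
proof -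
  obtain d where d: "d > 0" "\<forall>x\<in>F. x \<noteq> q \<longrightarrow> d \<le> dist q x"
    using finite_set_avoid[OF fin] by blast
  \<comment> \<open>\<open>e < d\<close> keeps the other points of \<open>F\<close> out of the
    closed \<open>e\<close>-ball; \<open>2 * e \<le> \<epsilon>\<close> pays for the last triangle
    inequality.\<close>
  define e where "e = min (d/2) \<epsilon> / 2"
  have e: "e > 0" "e < d" "2 * e \<le> \<epsilon>" using d \<open>\<epsilon> > 0\<close> by (auto simp: e_def)
  have stable: "\<exists>r>0. \<forall>x\<in>M. \<forall>t\<ge>0. dist q x < r \<longrightarrow> dist q (phi t x) < e" if pos: "e > 0" for e
  proof -
    obtain U where U: "open U" "q \<in> U" "\<forall>t\<ge>0. \<forall>x\<in>U \<inter> M. phi t x \<in> ball q e"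
      using q[unfolded lyap_stable_def, rule_format, of "ball q e"] pos by auto
    obtain r where "r > 0" "ball q r \<subseteq> U" using openE[OF U(1,2)] .
    then show ?thesis using U(3) by (intro exI[of _ r]) (auto simp: subset_iff)
  qed
  obtain r0 where r0: "r0 > 0" "\<And>x t. \<lbrakk>x \<in> M; t \<ge> 0; dist q x < r0\<rbrakk> \<Longrightarrow> dist q (phi t x) < e"
    using stable[OF e(1)] by blast
  \<comment> \<open>Halving places the closed \<open>r\<close>-ball inside the open
    \<open>r0\<close>-ball.\<close>
  define r where "r = r0 / 2"
  have r: "r > 0" using r0 by (simp add: r_def)
  obtain r' where r': "r' > 0" "\<And>x t. \<lbrakk>x \<in> M; t \<ge> 0; dist q x < r'\<rbrakk> \<Longrightarrow> dist q (phi t x) < r/2"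
    using stable[of "r/2"] r by auto
  \<comment> \<open>An orbit that never came within \<open>r'\<close> would have an \<omega>-limit
    point in the closed shell between \<open>r'\<close> and \<open>e\<close>, where \<open>F\<close>
    has no point.\<close>
  have enter: "\<exists>t\<ge>0. dist q (phi t x) < r'" if x: "x \<in> M" "dist q x \<le> r" for x
  proof (rule ccontr)
    assume "\<not> ?thesis"
    then have "phi t x \<in> cball q e - ball q r'" if "t \<ge> 0" for t
      using that r0(2)[of x t] x r0(1) by (fastforce simp: r_def)
    moreover have "closed (cball q e - ball q r')" by auto
    ultimately obtain y where "y \<in> omega_limit phi x" "y \<in> cball q e - ball q r'"
      using omega_limit_inter x(1) by blast
    then show False using F[OF x(1)] d(2) e r'(1) by fastforce
  qed
  \<comment> \<open>Counterexamples with growing times accumulate at some \<open>l\<close>. The time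
    at which \<open>l\<close> enters the \<open>r'\<close>-ball also serves nearby points, which
    then stay within \<open>r/2\<close> forever. \<open>Suc\<close> makes the common time positive,
    as the later division by it requires.\<close>
  have "\<exists>n. \<forall>x\<in>M. dist q x \<le> r \<longrightarrow> dist q (phi (real (Suc n)) x) < r/2"
  proof (rule ccontr)
    assume "\<not> ?thesis"
    then obtain x where x: "\<And>n. x n \<in> M" "\<And>n. dist q (x n) \<le> r"
        "\<And>n. dist q (phi (real (Suc n)) (x n)) \<ge> r/2"
      by (metis not_le)
    obtain l g where l: "l \<in> M" "strict_mono (g :: nat \<Rightarrow> nat)" "(\<lambda>n. x (g n)) \<longlonglongrightarrow> l"
      using seq_compactE[OF compact[THEN compact_imp_seq_compact], of x] x(1) by (auto simp: o_def)
    have "dist q l \<le> r"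
      by (rule LIMSEQ_le_const2[OF tendsto_dist[OF tendsto_const l(3)]]) (use x in auto)
    then obtain t where t: "t \<ge> 0" "dist q (phi t l) < r'" using enter l by blast
    have "(\<lambda>n. phi t (x (g n))) \<longlonglongrightarrow> phi t l"
      by (rule flow_tendsto) (use l x in auto)
    then have "(\<lambda>n. dist q (phi t (x (g n)))) \<longlonglongrightarrow> dist q (phi t l)" by (intro tendsto_intros)
    then have "\<forall>\<^sub>F n in sequentially. dist q (phi t (x (g n))) < r'"
      using t(2) by (rule order_tendstoD)
    moreover have "\<forall>\<^sub>F n in sequentially. t \<le> real n" using eventually_ge_at_top[of "nat \<lceil>t\<rceil>"] by eventually_elim (simp add: nat_ceiling_le_eq)
    ultimately have "\<forall>\<^sub>F n in sequentially. False"
    proof eventually_elim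
      case (elim n)
      have "real n \<le> real (g n)" using seq_suble[OF l(2)] by simp
      then have "dist q (phi (real (Suc (g n)) - t) (phi t (x (g n)))) < r/2"
        using elim x by (intro r') auto
      then show False using x(1)[of "g n"] x(3)[of "g n"] by (simp add: flow_add[symmetric])
    qed
    then show False by simp
  qed
  then obtain T where T: "T > 0" "\<And>x. \<lbrakk>x \<in> M; dist q x \<le> r\<rbrakk> \<Longrightarrow> dist q (phi T x) < r/2"
    by (metis of_nat_0_less_iff zero_less_Suc)
  \<comment> \<open>The bound \<open>r/2\<close> closes the induction at multiples of
    \<open>T\<close>; the bound \<open>e\<close> controls the times in between.\<close>
  obtain \<delta> where \<delta>: "\<delta> > 0"
    "\<And>\<xi> t s. \<lbrakk>pseudotrajectory dist M phi \<delta> \<xi>; s \<in> {0..T}\<rbrakk> \<Longrightarrow> dist (\<xi> (t + s)) (phi s (\<xi> t)) < min (r/2) e"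
    using pseudotrajectory_near_orbit[of "min (r/2) e" T] r e(1) by auto
  show thesis
  proof (rule that[of "min r \<delta>"])
    fix \<xi> s t
    assume p: "pseudotrajectory dist M phi (min r \<delta>) \<xi>" and s: "dist q (\<xi> s) < min r \<delta>" "s \<le> t"
    have p': "pseudotrajectory dist M phi \<delta> \<xi>" and M: "\<xi> t \<in> M" for t
      using p by (auto simp: pseudotrajectory_def)
    have it: "dist q (\<xi> (s + real k * T)) < r" for k
    proof (induction k)
      case 0 then show ?case using s by simp
    next
      case (Suc k)
      have "dist q (phi T (\<xi> (s + real k * T))) < r/2" using T Suc M by auto
      moreover have "dist (\<xi> (s + real k * T + T)) (phi T (\<xi> (s + real k * T))) < r/2"
        using \<delta>(2)[OF p', of T "s + real k * T"] T by auto
      ultimately have "dist q (\<xi> (s + real k * T + T)) < r" 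
        using dist_triangle_half_r dist_commute by metis
      then show ?case by (simp add: algebra_simps)
    qed
    define k where "k = nat \<lfloor>(t - s) / T\<rfloor>"
    define u where "u = t - s - real k * T"
    have k: "real k \<le> (t - s) / T" "(t - s) / T \<le> real k + 1"
      using s T unfolding k_def by (auto simp: of_nat_nat zero_le_divide_iff) 
    then have u: "u \<in> {0..T}" using T by (auto simp: u_def field_simps)
    have "dist q (phi u (\<xi> (s + real k * T))) < e"
      using it[of k] u M r by (intro r0) (auto simp: r_def)
    moreover have "dist (\<xi> (s + real k * T + u)) (phi u (\<xi> (s + real k * T))) < e"
      using \<delta>(2)[OF p' u] by simp
    moreover have "s + real k * T + u = t" by (simp add: u_def)
    ultimately show "dist q (\<xi> t) < \<epsilon>"
      using e(3) dist_triangle2[of q "\<xi> t" "phi u (\<xi> (s + real k * T))"] by simp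
  qed (use r \<delta> in auto)
qed

text \<open>Each orbit meets \<open>W\<close> because its \<omega>-limit set is nonempty and lies in
  \<open>W\<close>. Without a common bound, points needing longer and longer would accumulate at
  some \<open>l\<close>, whose own entrance time works for all points near it since \<open>W\<close>
  is open.\<close>

lemma entrance_time:
  assumes "open W" "\<And>x. x \<in> M \<Longrightarrow> omega_limit phi x \<subseteq> W"
  obtains T where "T > 0" "\<And>x. x \<in> M \<Longrightarrow> \<exists>t\<in>{0..T}. phi t x \<in> W"
proof -
  have "\<exists>n. \<forall>x\<in>M. \<exists>t\<in>{0..real (Suc n)}. phi t x \<in> W"
  proof (rule ccontr)
    assume "\<not> ?thesis"
    then obtain x where x: "\<And>n. x n \<in> M" "\<And>n t. t \<in> {0..real (Suc n)} \<Longrightarrow> phi t (x n) \<notin> W"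
      by metis
    obtain l g where l: "l \<in> M" "strict_mono (g :: nat \<Rightarrow> nat)" "(\<lambda>n. x (g n)) \<longlonglongrightarrow> l"
      using seq_compactE[OF compact[THEN compact_imp_seq_compact], of x] x(1) by (auto simp: o_def)
    obtain t where t: "t \<ge> 0" "phi t l \<in> W"
      using omega_limit_inter[of l "- W"] assms l(1) by (metis ComplD ComplI closed_Compl subsetD)
    have "(\<lambda>n. phi t (x (g n))) \<longlonglongrightarrow> phi t l"
      by (rule flow_tendsto) (use l x in auto)
    then have "\<forall>\<^sub>F n in sequentially. phi t (x (g n)) \<in> W"
      using assms(1) t(2) by (rule topological_tendstoD)
    moreover have "\<forall>\<^sub>F n in sequentially. t \<le> real n" using eventually_ge_at_top[of "nat \<lceil>t\<rceil>"] by eventually_elim (simp add: nat_ceiling_le_eq)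
    ultimately have "\<forall>\<^sub>F n in sequentially. False"
    proof eventually_elim
      case (elim n)
      have "real n \<le> real (g n)" using seq_suble[OF l(2)] by simp
      then show False using elim x(2)[of t "g n"] t by auto
    qed
    then show False by simp
  qed
  then show thesis using that by (metis of_nat_0_less_iff zero_less_Suc)
qed

text \<open>Near a stable point a pseudotrajectory is trapped for the future, near an unstable one
  for the past, and it comes close to the limit set in every window of a fixed length. Hence a
  switch from unstable to stable takes bounded time. The orbit of \<open>\<xi> a\<close> is itself a
  pseudotrajectory and obeys the same bounds, which makes it a candidate for shadowing.\<close>

lemma stable_unstable_pseudotrajectory:
  assumes fin: "finite (limit_set M phi)"
    and sing: "limit_set M phi \<subseteq> Sing M phi"
    and lyap: "\<forall>p\<in>limit_set M phi. lyap_stable M phi p \<or> lyap_unstable M phi p"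
    and "\<epsilon> > 0"
  obtains T \<delta> where "T > 0" "\<delta> > 0"
    "\<And>\<xi>. pseudotrajectory dist M phi \<delta> \<xi> \<Longrightarrow>
       (\<exists>p\<in>Sing M phi. \<forall>t. dist p (\<xi> t) < \<epsilon>) \<or>
       (\<exists>a p q. (\<forall>t\<le>a. dist p (\<xi> t) < \<epsilon>) \<and> (\<forall>t\<ge>a + T. dist q (\<xi> t) < \<epsilon>) \<and>
          (\<forall>s\<le>0. dist p (phi s (\<xi> a)) < \<epsilon>) \<and> (\<forall>s\<ge>T. dist q (phi s (\<xi> a)) < \<epsilon>))"
proof -
  define L where "L = limit_set M phi"
  define S where "S = {p \<in> L. lyap_stable M phi p}"
  define U where "U = {p \<in> L. lyap_unstable M phi p}"
  have finS: "finite S" "finite U" "finite L" using fin by (auto simp: S_def U_def L_def)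
  have L: "L = S \<union> U" using lyap by (auto simp: S_def U_def L_def)
  have omega: "omega_limit phi x \<subseteq> L" and alpha: "alpha_limit phi x \<subseteq> L" if "x \<in> M" for x
    using that by (auto simp: L_def limit_set_def)
  have "\<forall>\<^sub>F r in at_right 0. \<forall>\<xi> s t. pseudotrajectory dist M phi r \<xi> \<longrightarrow> dist q (\<xi> s) < r \<longrightarrow> s \<le> t \<longrightarrow> dist q (\<xi> t) < \<epsilon>"
    if q: "q \<in> S" for q
  proof -
    have "lyap_stable M phi q" using q by (simp add: S_def)
    note trap = trapping[OF this finS(3) omega \<open>\<epsilon> > 0\<close>]
    obtain r where r: "r > 0"
      "\<And>\<xi> s t. \<lbrakk>pseudotrajectory dist M phi r \<xi>; dist q (\<xi> s) < r; s \<le> t\<rbrakk> \<Longrightarrow> dist q (\<xi> t) < \<epsilon>"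
      using trap by blast
    show ?thesis
    proof (rule eventually_at_rightI[of 0 r])
      fix r' assume r': "r' \<in> {0<..<r}"
      then have "pseudotrajectory dist M phi r \<xi>" if "pseudotrajectory dist M phi r' \<xi>" for \<xi>
        using that by (intro pseudotrajectory_mono[of r' \<xi> r]) auto
      then show "\<forall>\<xi> s t. pseudotrajectory dist M phi r' \<xi> \<longrightarrow> dist q (\<xi> s) < r' \<longrightarrow> s \<le> t \<longrightarrow> dist q (\<xi> t) < \<epsilon>"
        using r(2) r' by (meson greaterThanLessThan_iff less_trans)
    qed (rule r)
  qed
  \<comment> \<open>Eventual properties merge over the finitely many points, so that one radius will
    serve all of them.\<close>
  then have 1: "\<forall>\<^sub>F r in at_right 0. \<forall>q\<in>S. \<forall>\<xi> s t. pseudotrajectory dist M phi r \<xi> \<longrightarrow> dist q (\<xi> s) < r \<longrightarrow> s \<le> t \<longrightarrow> dist q (\<xi> t) < \<epsilon>"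
    using finS(1) by (simp add: eventually_ball_finite)
  have "\<forall>\<^sub>F r in at_right 0. \<forall>\<xi> s t. pseudotrajectory dist M phi r \<xi> \<longrightarrow> dist q (\<xi> s) < r \<longrightarrow> t \<le> s \<longrightarrow> dist q (\<xi> t) < \<epsilon>"
    if q: "q \<in> U" for q
  proof -
    interpret rev: compact_flow M "\<lambda>t. phi (- t)" by (rule compact_flow_reverse)
    have rev_stable: "lyap_stable M (\<lambda>t. phi (- t)) q"
      unfolding lyap_stable_def
    proof (intro allI impI)
      fix V assume "open V \<and> q \<in> V"
      then obtain W where "open W" "q \<in> W" "\<forall>t\<le>0. \<forall>x\<in>W \<inter> M. phi t x \<in> V"
        using q unfolding U_def lyap_unstable_def by blast
      then show "\<exists>W. open W \<and> q \<in> W \<and> (\<forall>t\<ge>0. \<forall>x\<in>W \<inter> M. phi (- t) x \<in> V)"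
        by (intro exI[of _ W]) auto
    qed
    have "omega_limit (\<lambda>t. phi (- t)) x \<subseteq> alpha_limit phi x" for x
      unfolding omega_limit_def alpha_limit_def
    proof safe
      fix y and s :: "nat \<Rightarrow> real"
      assume "filterlim s at_top sequentially" "(\<lambda>n. phi (- s n) x) \<longlonglongrightarrow> y"
      then show "\<exists>s. filterlim s at_bot sequentially \<and> (\<lambda>n. phi (s n) x) \<longlonglongrightarrow> y"
        by (intro exI[of _ "\<lambda>n. - s n"]) (auto simp: filterlim_uminus_at_top)
    qed
    then have rev_omega: "omega_limit (\<lambda>t. phi (- t)) x \<subseteq> L" if "x \<in> M" for x
      using alpha[OF that] by blast
    note trap = rev.trapping[OF rev_stable finS(3) rev_omega \<open>\<epsilon> > 0\<close>]
    obtain r0 where r0: "r0 > 0"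
      "\<And>\<xi> s t. \<lbrakk>pseudotrajectory dist M (\<lambda>t. phi (- t)) r0 \<xi>; dist q (\<xi> s) < r0; s \<le> t\<rbrakk> \<Longrightarrow> dist q (\<xi> t) < \<epsilon>"
      using trap by blast
    obtain r1 where r1: "r1 > 0"
      "\<And>\<xi>. pseudotrajectory dist M phi r1 \<xi> \<Longrightarrow> pseudotrajectory dist M (\<lambda>t. phi (- t)) r0 (\<lambda>t. \<xi> (- t))"
      using pseudotrajectory_reverse[OF r0(1)] by blast
    show ?thesis
    proof (rule eventually_at_rightI[of 0 "min r0 r1"])
      fix r' assume r': "r' \<in> {0<..<min r0 r1}"
      show "\<forall>\<xi> s t. pseudotrajectory dist M phi r' \<xi> \<longrightarrow> dist q (\<xi> s) < r' \<longrightarrow> t \<le> s \<longrightarrow> dist q (\<xi> t) < \<epsilon>"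
      proof (intro allI impI)
        fix \<xi> s t
        assume *: "pseudotrajectory dist M phi r' \<xi>" "dist q (\<xi> s) < r'" "t \<le> s"
        then have "pseudotrajectory dist M phi r1 \<xi>"
          using r' by (intro pseudotrajectory_mono[of r' \<xi> r1]) auto
        from r0(2)[OF r1(2)[OF this], of "- s" "- t"] show "dist q (\<xi> t) < \<epsilon>"
          using * r' by auto
      qed
    qed (use r0 r1 in auto)
  qed
  then have 2: "\<forall>\<^sub>F r in at_right 0. \<forall>q\<in>U. \<forall>\<xi> s t. pseudotrajectory dist M phi r \<xi> \<longrightarrow> dist q (\<xi> s) < r \<longrightarrow> t \<le> s \<longrightarrow> dist q (\<xi> t) < \<epsilon>"
    using finS(2) by (simp add: eventually_ball_finite)
  have "\<forall>\<^sub>F r in at_right (0::real). r > 0" by (rule eventually_at_right_less)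
  from eventually_happens'[OF trivial_limit_at_right_real eventually_conj[OF this eventually_conj[OF 1 2]]]
  obtain r where r: "r > 0" and S: "\<forall>q\<in>S. \<forall>\<xi> s t. pseudotrajectory dist M phi r \<xi> \<longrightarrow> dist q (\<xi> s) < r \<longrightarrow> s \<le> t \<longrightarrow> dist q (\<xi> t) < \<epsilon>"
    and U: "\<forall>q\<in>U. \<forall>\<xi> s t. pseudotrajectory dist M phi r \<xi> \<longrightarrow> dist q (\<xi> s) < r \<longrightarrow> t \<le> s \<longrightarrow> dist q (\<xi> t) < \<epsilon>"
    by (elim exE conjE)
  have stable: "dist q (\<xi> t) < \<epsilon>"
    if "q \<in> S" "pseudotrajectory dist M phi r \<xi>" "dist q (\<xi> s) < r" "s \<le> t" for q \<xi> s t
    using S that by blast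
  have unstable: "dist q (\<xi> t) < \<epsilon>"
    if "q \<in> U" "pseudotrajectory dist M phi r \<xi>" "dist q (\<xi> s) < r" "t \<le> s" for q \<xi> s t
    using U that by blast
  \<comment> \<open>The radii add up to \<open>r/4 + r/4\<close> for the visit of the
    pseudotrajectory, and to \<open>r/2 + r/4 < r\<close> for the orbit of
    \<open>\<xi> a\<close>.\<close>
  obtain T where T: "T > 0" "\<And>x. x \<in> M \<Longrightarrow> \<exists>t\<in>{0..T}. phi t x \<in> (\<Union>q\<in>L. ball q (r/4))"
  proof (rule entrance_time[of "\<Union>q\<in>L. ball q (r/4)"])
    fix x assume "x \<in> M"
    then show "omega_limit phi x \<subseteq> (\<Union>q\<in>L. ball q (r/4))" using omega[of x] r by force
  qed auto
  have r4: "r/4 > 0" using r by simp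
  \<comment> \<open>The extra unit is needed because the visit after \<open>a\<close> is sought in a
    window of length \<open>T\<close> that opens at \<open>a + 1\<close>.\<close>
  obtain \<delta>0 where \<delta>0: "\<delta>0 > 0"
    "\<And>\<xi> t s. \<lbrakk>pseudotrajectory dist M phi \<delta>0 \<xi>; s \<in> {0..T + 1}\<rbrakk> \<Longrightarrow> dist (\<xi> (t + s)) (phi s (\<xi> t)) < r/4"
    using pseudotrajectory_near_orbit[OF r4, of "T + 1"] by blast
  show thesis
  proof (rule that[of "T + 1" "min r \<delta>0"])
    fix \<xi>
    assume p: "pseudotrajectory dist M phi (min r \<delta>0) \<xi>"
    have p1: "pseudotrajectory dist M phi r \<xi>" and p2: "pseudotrajectory dist M phi \<delta>0 \<xi>"
      using pseudotrajectory_mono[OF p] by auto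
    have M: "\<xi> t \<in> M" for t
      using p by (auto simp: pseudotrajectory_def)
    have hit: "\<exists>s\<in>{t..t + T}. \<exists>q\<in>L. dist q (\<xi> s) < r/2" for t
    proof -
      obtain s q where s: "s \<in> {0..T}" "q \<in> L" "dist q (phi s (\<xi> t)) < r/4"
        using T(2)[OF M[of t]] by auto
      moreover have "dist (\<xi> (t + s)) (phi s (\<xi> t)) < r/4" using \<delta>0(2)[OF p2] s by auto
      ultimately have "dist q (\<xi> (t + s)) < r/2"
        using dist_triangle2[of q "\<xi> (t + s)" "phi s (\<xi> t)"] by simp
      then show ?thesis using s by (intro bexI[of _ "t + s"] bexI[of _ q]) auto
    qed
    \<comment> \<open>The times spent near unstable points; a close visit to the limit set outside
      \<open>A\<close> must be to a stable point.\<close>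
    define A where "A = {t. \<exists>p\<in>U. dist p (\<xi> t) < r}"
    have not_A: "q \<in> S" if "t \<notin> A" "q \<in> L" "dist q (\<xi> t) < r/2" for q t
    proof -
      have "dist q (\<xi> t) < r" using that(3) r by simp
      then show ?thesis using that(1,2) L unfolding A_def by blast
    qed
    consider "\<not> bdd_above A" | "A = {}" | "A \<noteq> {}" "bdd_above A" by blast
    then show "(\<exists>p\<in>Sing M phi. \<forall>t. dist p (\<xi> t) < \<epsilon>) \<or>
       (\<exists>a p q. (\<forall>t\<le>a. dist p (\<xi> t) < \<epsilon>) \<and> (\<forall>t\<ge>a + (T + 1). dist q (\<xi> t) < \<epsilon>) \<and>
          (\<forall>s\<le>0. dist p (phi s (\<xi> a)) < \<epsilon>) \<and> (\<forall>s\<ge>T + 1. dist q (phi s (\<xi> a)) < \<epsilon>))"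
    proof cases
      case 1
      \<comment> \<open>One unstable point is approached at arbitrarily late times, and trapping
        into the past then covers all times.\<close>
      then have "\<exists>u\<in>A. t \<le> u" for t
        unfolding bdd_above_def by (meson linear)
      then have "\<exists>u\<ge>t. \<exists>p\<in>U. dist p (\<xi> u) < r" for t
        unfolding A_def by blast
      from frequently_at_top_finite[OF finS(2) this]
      obtain p where "p \<in> U" "\<forall>t. \<exists>u\<ge>t. dist p (\<xi> u) < r" by blast
      then have "\<forall>t. dist p (\<xi> t) < \<epsilon>" "p \<in> Sing M phi"
        using unstable[OF _ p1] sing unfolding U_def L_def by blast+
      then show ?thesis by blast
    next
      case 2
      \<comment> \<open>All visits are now to stable points, and one of these is approached at
        arbitrarily early times; the sign change fits the past to the pigeonhole lemma.\<close>
      have "\<exists>u\<ge>t. \<exists>q\<in>S. dist q (\<xi> (- u)) < r" for t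
      proof -
        obtain s q where s: "s \<in> {- t - T..- t}" "q \<in> L" "dist q (\<xi> s) < r/2"
          using hit[of "- t - T"] by auto
        then have "q \<in> S" using 2 not_A by blast
        then show ?thesis using s r by (intro exI[of _ "- s"] conjI bexI[of _ q]) auto
      qed
      from frequently_at_top_finite[OF finS(1) this]
      obtain q where q: "q \<in> S" "\<forall>t. \<exists>u\<ge>t. dist q (\<xi> (- u)) < r" by blast
      have "dist q (\<xi> t) < \<epsilon>" for t
      proof -
        obtain u where "u \<ge> - t" "dist q (\<xi> (- u)) < r" using q(2) by blast
        then show ?thesis using stable[OF q(1) p1, of "- u" t] by simp
      qed
      moreover have "q \<in> Sing M phi" using q(1) sing by (auto simp: S_def L_def)
      ultimately show ?thesis by blast
    next
      case 3
      \<comment> \<open>\<open>a\<close> is within 1 of the supremum, so no time from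
        \<open>a + 1\<close> on lies in \<open>A\<close> and the visit found there is to a stable
        point.\<close>
      obtain a where a: "a \<in> A" "Sup A - 1 < a"
        using less_cSupD[OF 3(1), of "Sup A - 1"] by auto
      obtain p where p: "p \<in> U" "dist p (\<xi> a) < r" using a(1) by (auto simp: A_def)
      obtain s q where s: "s \<in> {a + 1..a + 1 + T}" "q \<in> L" "dist q (\<xi> s) < r/2"
        using hit[of "a + 1"] by blast
      have "s \<notin> A" using s(1) a(2) cSup_upper[OF _ 3(2), of s] by auto
      then have "q \<in> S" using s not_A by blast
      have "dist (\<xi> (a + (s - a))) (phi (s - a) (\<xi> a)) < r/4" by (rule \<delta>0(2)[OF p2]) (use s in auto)
      then have "dist q (phi (s - a) (\<xi> a)) < r"
        using s(3) r dist_triangle[of q "phi (s - a) (\<xi> a)" "\<xi> s"] by simp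
      note orbit = orbit_pseudotrajectory[OF M[of a] r]
      have "\<forall>t\<le>a. dist p (\<xi> t) < \<epsilon>" using unstable[OF p(1) p1 p(2)] by blast
      moreover have "\<forall>t\<ge>a + (T + 1). dist q (\<xi> t) < \<epsilon>"
        using stable[OF \<open>q \<in> S\<close> p1, of s] s r by auto
      moreover have "\<forall>t\<le>0. dist p (phi t (\<xi> a)) < \<epsilon>"
        using unstable[OF p(1) orbit, of 0] p(2) M by simp
      moreover have "\<forall>t\<ge>T + 1. dist q (phi t (\<xi> a)) < \<epsilon>"
        using stable[OF \<open>q \<in> S\<close> orbit \<open>dist q (phi (s - a) (\<xi> a)) < r\<close>] s by auto
      ultimately show ?thesis by blast
    qed
  qed (use T r \<delta>0 in auto)
qed

section \<open>Rigidity of time and shadowing at unit speed\<close>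

lemma fixed_of_small_periods:
  assumes x: "x \<in> M" and "\<eta> > 0" and fixed: "\<And>u. \<lbrakk>0 < u; u < \<eta>\<rbrakk> \<Longrightarrow> phi u x = x"
  shows "x \<in> Sing M phi"
proof -
  have pos: "phi t x = x" if t: "t > 0" for t
  proof -
    \<comment> \<open>Each of \<open>N\<close> equal parts of \<open>t\<close> is shorter than
      \<open>\<eta>\<close> and hence fixes \<open>x\<close>; so does their sum.\<close>
    obtain N where N: "t / \<eta> < real N" using reals_Archimedean2 by blast
    then have N0: "real N > 0" using t \<open>\<eta> > 0\<close> by (meson divide_pos_pos less_trans)
    have "phi (t / real N) x = x"
      by (rule fixed) (use t N N0 \<open>\<eta> > 0\<close> in \<open>auto simp: field_simps\<close>)
    then have "phi (real n * (t / real N)) x = x" for n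
      by (induction n) (simp_all add: x distrib_right flow_add del: times_divide_eq_right)
    from this[of N] show ?thesis using N0 by simp
  qed
  have "phi t x = x" for t
  proof (cases t "0::real" rule: linorder_cases)
    case less
    have "phi t (phi (- t) x) = x" using flow_add[OF x, of t "- t"] x by simp
    then show ?thesis using pos[of "- t"] less by simp
  qed (use pos x in auto)
  then show ?thesis using x by (simp add: Sing_def)
qed

text \<open>Otherwise some reparametrizations drift by at least \<open>\<eta>\<close> although
  \<open>c\<close> tends to 0. By continuity the drift takes every value \<open>u\<close> below
  \<open>\<eta>\<close> on the way, and in the limit each such \<open>u\<close> becomes a period of
  a point \<open>l\<close> at distance at least \<open>r\<close> from the singularities. Having all
  small periods makes \<open>l\<close> a singularity, a contradiction.\<close>

lemma time_rigidity:
  assumes "r > 0" "\<eta> > 0"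
  obtains c where "c > 0"
    "\<And>y g s. \<lbrakk>y \<in> M; \<forall>p\<in>Sing M phi. r \<le> dist p y; continuous_on {0..T} g; g 0 = 0;
       \<And>s. s \<in> {0..T} \<Longrightarrow> dist (phi s y) (phi (g s) y) < c; s \<in> {0..T}\<rbrakk> \<Longrightarrow> \<bar>g s - s\<bar> < \<eta>"
proof -
  have "\<exists>c>0. \<forall>y\<in>M. \<forall>g. \<forall>s\<in>{0..T}. (\<forall>p\<in>Sing M phi. r \<le> dist p y) \<longrightarrow> continuous_on {0..T} g \<longrightarrow>
     g 0 = 0 \<longrightarrow> (\<forall>s\<in>{0..T}. dist (phi s y) (phi (g s) y) < c) \<longrightarrow> \<bar>g s - s\<bar> < \<eta>"
  proof (rule ccontr)
    assume neg: "\<not> ?thesis"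
    have "\<exists>y g s. y \<in> M \<and> s \<in> {0..T} \<and> (\<forall>p\<in>Sing M phi. r \<le> dist p y) \<and> continuous_on {0..T} g \<and>
       g 0 = 0 \<and> (\<forall>s\<in>{0..T}. dist (phi s y) (phi (g s) y) < inverse (real (Suc n))) \<and> \<eta> \<le> \<bar>g s - s\<bar>" for n
    proof -
      have "inverse (real (Suc n)) > 0" by simp
      with neg show ?thesis unfolding not_less[symmetric] by blast
    qed
    then obtain y g s where y: "\<And>n. y n \<in> M" "\<And>n. s n \<in> {0..T}"
      "\<And>n p. p \<in> Sing M phi \<Longrightarrow> r \<le> dist p (y n)" "\<And>n. continuous_on {0..T} (g n)" "\<And>n. g n 0 = (0::real)"
      "\<And>n u. u \<in> {0..T} \<Longrightarrow> dist (phi u (y n)) (phi (g n u) (y n)) < inverse (real (Suc n))"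
      "\<And>n. \<eta> \<le> \<bar>g n (s n) - s n\<bar>"
      by metis
    obtain l k where l: "l \<in> M" "strict_mono (k :: nat \<Rightarrow> nat)" "(\<lambda>n. y (k n)) \<longlonglongrightarrow> l"
      using seq_compactE[OF compact[THEN compact_imp_seq_compact], of y] y(1) by (auto simp: o_def)
    have far: "r \<le> dist p l" if "p \<in> Sing M phi" for p
      by (rule LIMSEQ_le_const[OF tendsto_dist[OF tendsto_const l(3)]]) (use y(3) that in auto)
    have "phi u l = l" if u: "0 < u" "u < \<eta>" for u
    proof -
      have "\<exists>v\<ge>0. v \<le> s n \<and> \<bar>g n v - v\<bar> = u" for n
      proof (rule IVT')
        show "continuous_on {0..s n} (\<lambda>v. \<bar>g n v - v\<bar>)"
          using y(2)[of n] by (intro continuous_intros continuous_on_subset[OF y(4)[of n]]) auto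
      qed (use y(2)[of n] y(5,7)[of n] u in auto)
      then obtain v where v: "\<And>n. 0 \<le> v n" "\<And>n. v n \<le> s n" "\<And>n. \<bar>g n (v n) - v n\<bar> = u" by metis
      have v': "v n \<in> {0..T}" for n using v(1,2)[of n] y(2)[of n] by auto
      \<comment> \<open>The drift has absolute value exactly \<open>u\<close>, so time and signed
        drift together stay in a compact set; passing to a subsequence also settles the
        sign.\<close>
      define z where "z = (\<lambda>n. (v (k n), g (k n) (v (k n)) - v (k n)))"
      have z: "z n \<in> {0..T} \<times> {-u, u}" for n
        using v'[of "k n"] v(3)[of "k n"] by (auto simp: z_def abs_if split: if_splits)
      have "seq_compact ({0..T} \<times> {-u, u})"
        by (intro compact_imp_seq_compact compact_Times) auto
      then obtain m j where j: "m \<in> {0..T} \<times> {-u, u}" "strict_mono (j :: nat \<Rightarrow> nat)" "(z \<circ> j) \<longlonglongrightarrow> m"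
        using allI[of "\<lambda>n. z n \<in> _", OF z] by (rule seq_compactE)
      obtain V W where m: "m = (V, W)" by (cases m)
      have V: "(\<lambda>n. v (k (j n))) \<longlonglongrightarrow> V" using tendsto_fst[OF j(3)] by (simp add: m z_def o_def)
      have W: "(\<lambda>n. g (k (j n)) (v (k (j n))) - v (k (j n))) \<longlonglongrightarrow> W"
        using tendsto_snd[OF j(3)] by (simp add: m z_def o_def)
      have G: "(\<lambda>n. g (k (j n)) (v (k (j n)))) \<longlonglongrightarrow> V + W"
        using tendsto_add[OF V W] by simp
      have Y: "(\<lambda>n. y (k (j n))) \<longlonglongrightarrow> l"
        using LIMSEQ_subseq_LIMSEQ[OF l(3) j(2)] by (simp add: o_def)
      have kj: "strict_mono (\<lambda>n. k (j n))" using l(2) j(2) by (simp add: strict_mono_def)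
      have "(\<lambda>n. dist (phi (v (k (j n))) (y (k (j n)))) (phi (g (k (j n)) (v (k (j n)))) (y (k (j n)))))
              \<longlonglongrightarrow> dist (phi V l) (phi (V + W) l)"
        by (intro tendsto_dist flow_tendsto V G Y y l)
      moreover have "(\<lambda>n. inverse (real (Suc (k (j n))))) \<longlonglongrightarrow> 0"
        using LIMSEQ_subseq_LIMSEQ[OF LIMSEQ_inverse_real_of_nat kj] by (simp add: o_def)
      ultimately have "dist (phi V l) (phi (V + W) l) \<le> 0"
        by (rule LIMSEQ_le) (use y(6) v' in \<open>auto intro!: exI[of _ 0] less_imp_le\<close>)
      then have "phi V l = phi (V + W) l" by simp
      \<comment> \<open>Cancelling \<open>phi V\<close> leaves the period \<open>W\<close>; if
        \<open>W = - u\<close>, applying \<open>phi u\<close> gives the period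
        \<open>u\<close>.\<close>
      then have "phi (- V) (phi V l) = phi (- V) (phi (V + W) l)" by simp
      then have "phi W l = l" using l(1) by (simp flip: flow_add)
      moreover have "W = u \<or> W = - u" using j(1) m by auto
      moreover have "phi u (phi (- u) l) = l" using flow_add[OF l(1), of u "- u"] l(1) by simp
      ultimately show ?thesis by metis
    qed
    then have "l \<in> Sing M phi" using fixed_of_small_periods[OF l(1) \<open>\<eta> > 0\<close>] by blast
    from far[OF this] show False using \<open>r > 0\<close> by simp
  qed
  then obtain c where "c > 0" "\<forall>y\<in>M. \<forall>g. \<forall>s\<in>{0..T}. (\<forall>p\<in>Sing M phi. r \<le> dist p y) \<longrightarrow> continuous_on {0..T} g \<longrightarrow>
     g 0 = 0 \<longrightarrow> (\<forall>s\<in>{0..T}. dist (phi s y) (phi (g s) y) < c) \<longrightarrow> \<bar>g s - s\<bar> < \<eta>" by blast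
  then show thesis by (intro that[of c]) blast+
qed

text \<open>If the shadowing orbit is far from all singularities at time \<open>a\<close>, time
  rigidity forces nearly unit speed. If it is near one, pseudotrajectory and orbit both linger there
  throughout the window, and the reparametrization can be replaced by one of exact unit speed. The
  choice of \<open>\<delta>\<close> does not depend on \<open>a\<close>.\<close>

lemma shadowing_unit_speed:
  assumes shadow: "oriented_shadowing dist M phi" and "\<epsilon> > 0" "\<eta> > 0" "T > 0"
  obtains \<delta> where "\<delta> > 0"
    "\<And>\<xi> a. pseudotrajectory dist M phi \<delta> \<xi> \<Longrightarrow>
       \<exists>x\<in>M. \<exists>h\<in>Rep. h a = 0 \<and> (\<forall>t\<in>{a..a + T}. \<bar>h t - (t - a)\<bar> < \<eta>) \<and>
         (\<forall>t. dist (\<xi> t) (phi (h t) x) < \<epsilon>)"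
proof -
  \<comment> \<open>The case near a singularity adds up \<open>2 * e\<close> and
    \<open>3 * e\<close>, which stays below \<open>8 * e\<close>.\<close>
  define e where "e = \<epsilon> / 8"
  have e: "e > 0" using \<open>\<epsilon> > 0\<close> by (simp add: e_def)
  obtain r0 where r0: "r0 > 0"
    "\<And>s t x y. \<lbrakk>\<bar>s\<bar> \<le> T + 1; \<bar>t\<bar> \<le> T + 1; x \<in> M; y \<in> M; \<bar>s - t\<bar> < r0; dist x y < r0\<rbrakk>
       \<Longrightarrow> dist (phi s x) (phi t y) < e"
    using flow_uniformly_continuous[OF e, of "T + 1"] by blast
  define r where "r = r0 / 2"
  have r: "r > 0" using r0 by (simp add: r_def)
  obtain c where c: "c > 0"
    "\<And>y g s. \<lbrakk>y \<in> M; \<forall>p\<in>Sing M phi. r \<le> dist p y; continuous_on {0..T} g; g 0 = 0;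
       \<And>s. s \<in> {0..T} \<Longrightarrow> dist (phi s y) (phi (g s) y) < c; s \<in> {0..T}\<rbrakk> \<Longrightarrow> \<bar>g s - s\<bar> < \<eta>"
    using time_rigidity[OF r \<open>\<eta> > 0\<close>, of T] by blast
  have c3: "c / 3 > 0" using c by simp
  obtain r1 where r1: "r1 > 0"
    "\<And>s t x y. \<lbrakk>\<bar>s\<bar> \<le> T + 1; \<bar>t\<bar> \<le> T + 1; x \<in> M; y \<in> M; \<bar>s - t\<bar> < r1; dist x y < r1\<rbrakk>
       \<Longrightarrow> dist (phi s x) (phi t y) < c / 3"
    using flow_uniformly_continuous[OF c3, of "T + 1"] by blast
  \<comment> \<open>The bounds \<open>r1\<close> and \<open>c / 3\<close> feed time rigidity,
    \<open>e\<close> is the plain accuracy, and \<open>m \<le> r = r0 / 2\<close> puts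
    \<open>\<xi> a\<close> within \<open>r0\<close> of any singularity that is within
    \<open>r\<close> of \<open>y\<close>.\<close>
  define m where "m = min (min r r1) (min (c / 3) e)"
  have m: "m > 0" "m \<le> r" "m \<le> r1" "m \<le> c / 3" "m \<le> e" using r r1 c3 e by (auto simp: m_def)
  obtain \<delta>1 where \<delta>1: "\<delta>1 > 0" "\<And>\<xi>. pseudotrajectory dist M phi \<delta>1 \<xi> \<Longrightarrow>
        \<exists>x\<in>M. \<exists>h\<in>Rep. \<forall>t. dist (\<xi> t) (phi (h t) x) < m"
    using shadow m(1) unfolding oriented_shadowing_def by blast
  obtain \<delta>2 where \<delta>2: "\<delta>2 > 0"
    "\<And>\<xi> t s. \<lbrakk>pseudotrajectory dist M phi \<delta>2 \<xi>; s \<in> {0..T + 1}\<rbrakk> \<Longrightarrow> dist (\<xi> (t + s)) (phi s (\<xi> t)) < m"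
    using pseudotrajectory_near_orbit[OF m(1), of "T + 1"] by blast
  show thesis
  proof (rule that[of "min \<delta>1 \<delta>2"])
    fix \<xi> a
    assume p: "pseudotrajectory dist M phi (min \<delta>1 \<delta>2) \<xi>"
    have p1: "pseudotrajectory dist M phi \<delta>1 \<xi>" and p2: "pseudotrajectory dist M phi \<delta>2 \<xi>"
      using pseudotrajectory_mono[OF p] by auto
    have M: "\<xi> t \<in> M" for t
      using p by (auto simp: pseudotrajectory_def)
    obtain x h0 where xh: "x \<in> M" "h0 \<in> Rep" "\<And>t. dist (\<xi> t) (phi (h0 t) x) < m"
      using \<delta>1(2)[OF p1] by blast
    \<comment> \<open>The orbit is restarted from its point at time \<open>a\<close>, so that the
      shifted \<open>h\<close> vanishes there.\<close>
    define y where "y = phi (h0 a) x"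
    define h where "h = (\<lambda>t. h0 t - h0 a)"
    have y: "y \<in> M" using xh by (simp add: y_def)
    have hRep: "h \<in> Rep" using Rep_shift[OF xh(2)] by (simp add: h_def)
    have ha: "h a = 0" by (simp add: h_def)
    have hmono: "h s < h t \<longleftrightarrow> s < t" "h s \<le> h t \<longleftrightarrow> s \<le> t" for s t
      using RepD(1)[OF hRep] by (auto simp: strict_mono_less strict_mono_less_eq)
    have close: "dist (\<xi> t) (phi (h t) y) < m" for t
      using xh(3)[of t] xh(1) by (simp add: y_def h_def flip: flow_add)
    have close_a: "dist (\<xi> a) y < m" using close[of a] ha y by simp
    have orbit: "dist (\<xi> t) (phi (t - a) (\<xi> a)) < m" if "t \<in> {a..a + T + 1}" for t
      using \<delta>2(2)[OF p2, of "t - a" a] that by simp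
    show "\<exists>x\<in>M. \<exists>h\<in>Rep. h a = 0 \<and> (\<forall>t\<in>{a..a + T}. \<bar>h t - (t - a)\<bar> < \<eta>) \<and>
         (\<forall>t. dist (\<xi> t) (phi (h t) x) < \<epsilon>)"
    proof (cases "\<forall>p\<in>Sing M phi. r \<le> dist p y")
      case True
      have "\<bar>h t - (t - a)\<bar> < \<eta>" if t: "t \<in> {a..a + T}" for t
      proof -
        have "\<bar>h (a + (t - a)) - (t - a)\<bar> < \<eta>"
        proof (rule c(2)[OF y True])
          show "continuous_on {0..T} (\<lambda>s. h (a + s))"
            by (rule continuous_on_compose2[OF RepD(2)[OF hRep]]) (auto intro!: continuous_intros)
        next
          fix s assume s: "s \<in> {0..T}"
          \<comment> \<open>Three errors of at most \<open>c / 3\<close> lead from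
            \<open>phi s y\<close> to \<open>phi s (\<xi> a)\<close>, on to
            \<open>\<xi> (a + s)\<close>, and on to \<open>phi (h (a + s)) y\<close>.\<close>
          have "dist (phi s y) (phi s (\<xi> a)) < c / 3"
            using s close_a m(3) r1(1) M y by (intro r1(2)) (auto simp: dist_commute)
          moreover have "dist (\<xi> (a + s)) (phi s (\<xi> a)) < m" using orbit[of "a + s"] s by simp
          ultimately show "dist (phi s y) (phi (h (a + s)) y) < c"
            using close[of "a + s"] m(4) dist_triangle[of "phi s y" "phi (h (a + s)) y" "phi s (\<xi> a)"]
              dist_triangle3[of "phi s (\<xi> a)" "phi (h (a + s)) y" "\<xi> (a + s)"] by linarith
        qed (use ha t in auto)
        then show ?thesis by simp
      qed
      moreover have "dist (\<xi> t) (phi (h t) y) < \<epsilon>" for t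
        using close[of t] m(5) \<open>\<epsilon> > 0\<close> by (simp add: e_def)
      ultimately show ?thesis using y hRep ha by blast
    next
      case False
      then obtain p where p: "p \<in> M" "\<And>t. phi t p = p" "dist p y < r"
        by (auto simp: Sing_def not_le)
      have near_y: "dist p (phi s y) < e" if "s \<in> {0..T + 1}" for s
        using r0(2)[of s s p y] that p y r0(1) by (simp add: r_def)
      have "dist p (\<xi> a) < r0"
        using dist_triangle2[of p "\<xi> a" y] p(3) close_a m(2) by (simp add: r_def)
      then have near_a: "dist p (phi s (\<xi> a)) < e" if "s \<in> {0..T + 1}" for s
        using r0(2)[of s s p "\<xi> a"] that p M r0(1) by simp
      have near_b: "dist p (\<xi> t) < 2 * e" if "t \<in> {a..a + T + 1}" for t
        using dist_triangle2[of p "\<xi> t" "phi (t - a) (\<xi> a)"] orbit[OF that] near_a[of "t - a"] m(5) that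
        by simp
      obtain b0 where b0: "h b0 = T + 1" using RepD(3)[OF hRep] by (metis surjD)
      \<comment> \<open>\<open>b\<close> leaves room after the window, and
        \<open>h b \<ge> T + 1\<close> leaves a positive amount of orbit time for the stretch from
        \<open>a + T\<close> to \<open>b\<close>.\<close>
      define b where "b = max (a + T + 1) b0"
      have b: "a + T < b" "T < h b"
        using hmono(2)[of b0 b] b0 by (auto simp: b_def)
      \<comment> \<open>Up to \<open>a + T + 1\<close> the pseudotrajectory follows the orbit of
        \<open>\<xi> a\<close>. Later times in the interval satisfy \<open>h t \<le> T + 1\<close>,
        where the orbit of \<open>y\<close> is still near \<open>p\<close>.\<close>
      have near_\<xi>: "dist p (\<xi> t) < 2 * e" if t: "t \<in> {a..b}" for t
      proof (cases "t \<le> a + T + 1")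
        case True then show ?thesis using near_b t by simp
      next
        case False
        then have "h t \<in> {0..T + 1}" using t hmono(2)[of a t] hmono(2)[of t b0] ha b0 by (auto simp: b_def)
        then show ?thesis
          using near_y[of "h t"] close[of t] m(5) dist_triangle2[of p "\<xi> t" "phi (h t) y"] by simp
      qed
      \<comment> \<open>\<open>h b\<close> may exceed the range of the uniform estimate; instead
        \<open>u = h t\<close> for some \<open>t\<close> in \<open>{a..b}\<close>, and
        \<open>\<xi> t\<close> is near \<open>p\<close>.\<close>
      have near_orbit: "dist p (phi u y) < 3 * e" if u: "u \<in> {0..h b}" for u
      proof -
        obtain t where t: "h t = u" using RepD(3)[OF hRep] by (metis surjD)
        then have "t \<in> {a..b}" using u hmono(2)[of a t] hmono(2)[of t b] ha by auto
        then show ?thesis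
          using near_\<xi>[of t] close[of t] t m(5) dist_triangle[of p "phi u y" "\<xi> t"] by simp
      qed
      \<comment> \<open>The slope that brings \<open>g\<close> to \<open>h b\<close> exactly at
        \<open>b\<close> after unit speed up to \<open>a + T\<close>.\<close>
      define \<kappa> where "\<kappa> = (h b - T) / (b - a - T)"
      have \<kappa>: "\<kappa> > 0" using b by (simp add: \<kappa>_def)
      \<comment> \<open>Everything happens near the singularity \<open>p\<close> during \<open>{a..b}\<close>, so \<open>h\<close> may be replaced there by
        any increasing function with the same values at the end points.\<close>
      define g where "g = (\<lambda>t. min (t - a) T + \<kappa> * max 0 (t - a - T))"
      define k where "k = (\<lambda>t. if t \<in> {a..b} then g t else h t)"
      have gmono: "g s < g t" if "s < t" for s t
      proof (cases "t - a \<le> T")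
        case True then show ?thesis using that by (simp add: g_def)
      next
        case False
        then have "\<kappa> * max 0 (s - a - T) < \<kappa> * max 0 (t - a - T)" using \<kappa> that by simp
        then show ?thesis using that by (simp add: g_def)
      qed
      have ga: "g a = 0" and gb: "g b = h b" using b \<open>T > 0\<close> by (auto simp: g_def \<kappa>_def)
      have "k \<in> Rep" unfolding k_def
      proof (rule Rep_glue[OF hRep])
        show "strict_mono_on {a..b} g" using gmono by (simp add: strict_mono_on_def)
        show "continuous_on {a..b} g" unfolding g_def by (intro continuous_intros)
      qed (use b ga gb ha \<open>T > 0\<close> in auto)
      moreover have "k a = 0" using b ga \<open>T > 0\<close> by (simp add: k_def)
      moreover have "k t = t - a" if "t \<in> {a..a + T}" for t using that b by (simp add: k_def g_def)
      moreover have "dist (\<xi> t) (phi (k t) y) < \<epsilon>" for t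
      proof (cases "t \<in> {a..b}")
        case True
        then have "g t \<in> {0..h b}" using gmono[of a t] gmono[of t b] ga gb by (cases "t = a"; cases "t = b"; force)
        then show ?thesis
          using True near_\<xi>[of t] near_orbit[of "g t"] dist_triangle3[of "\<xi> t" "phi (g t) y" p] e
          by (simp add: k_def e_def)
      next
        case False
        then have "k t = h t" by (auto simp: k_def)
        then show ?thesis using close[of t] m(5) \<open>\<epsilon> > 0\<close> by (simp add: e_def)
      qed
      ultimately show ?thesis using y \<open>\<eta> > 0\<close> by (intro bexI[of _ y] bexI[of _ k]) auto
    qed
  qed (use \<delta>1 \<delta>2 in auto)
qed

end

section \<open>The product flow\<close>

lemma pseudotrajectory_max_distD:
  assumes "pseudotrajectory max_dist (M1 \<times> M2) (prod_flow phi1 phi2) \<delta> \<xi>"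
  shows "pseudotrajectory dist M1 phi1 \<delta> (\<lambda>t. fst (\<xi> t))"
    and "pseudotrajectory dist M2 phi2 \<delta> (\<lambda>t. snd (\<xi> t))"
  using assms by (auto simp: pseudotrajectory_def max_dist_def prod_flow_def case_prod_unfold mem_Times_iff)

theorem theorem1p2:
  fixes M1 :: "'a::metric_space set" and M2 :: "'b::metric_space set"
    and phi1 :: "real \<Rightarrow> 'a \<Rightarrow> 'a" and phi2 :: "real \<Rightarrow> 'b \<Rightarrow> 'b"
  assumes "compact M1" and "compact M2"
    and "is_flow M1 phi1" and "is_flow M2 phi2"
    and "oriented_shadowing dist M1 phi1"
    and "finite (Sing M1 phi1)"
    and "finite (limit_set M2 phi2)"
    and "limit_set M2 phi2 \<subseteq> Sing M2 phi2"
    and "\<forall>p\<in>limit_set M2 phi2. lyap_stable M2 phi2 p \<or> lyap_unstable M2 phi2 p"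
  shows "oriented_shadowing max_dist (M1 \<times> M2) (prod_flow phi1 phi2)"
proof -
  interpret F1: compact_flow M1 phi1 using assms by unfold_locales
  interpret F2: compact_flow M2 phi2 using assms by unfold_locales
  show ?thesis
    unfolding oriented_shadowing_def
  proof (intro allI impI)
    fix \<epsilon> :: real
    assume "\<epsilon> > 0"
    then have e: "\<epsilon> / 2 > 0" by simp
    obtain T \<delta>1 where T: "T > 0" "\<delta>1 > 0"
      "\<And>\<xi>. pseudotrajectory dist M2 phi2 \<delta>1 \<xi> \<Longrightarrow>
         (\<exists>p\<in>Sing M2 phi2. \<forall>t. dist p (\<xi> t) < \<epsilon> / 2) \<or>
         (\<exists>a p q. (\<forall>t\<le>a. dist p (\<xi> t) < \<epsilon> / 2) \<and> (\<forall>t\<ge>a + T. dist q (\<xi> t) < \<epsilon> / 2) \<and>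
            (\<forall>s\<le>0. dist p (phi2 s (\<xi> a)) < \<epsilon> / 2) \<and> (\<forall>s\<ge>T. dist q (phi2 s (\<xi> a)) < \<epsilon> / 2))"
      using F2.stable_unstable_pseudotrajectory[OF assms(7-9) e] by blast
    obtain \<eta>0 where \<eta>0: "\<eta>0 > 0"
      "\<And>s t x y. \<lbrakk>\<bar>s\<bar> \<le> T + 2; \<bar>t\<bar> \<le> T + 2; x \<in> M2; y \<in> M2; \<bar>s - t\<bar> < \<eta>0; dist x y < \<eta>0\<rbrakk>
         \<Longrightarrow> dist (phi2 s x) (phi2 t y) < \<epsilon> / 2"
      using F2.flow_uniformly_continuous[OF e, of "T + 2"] by blast
    \<comment> \<open>\<open>\<eta> \<le> 1\<close> keeps \<open>h t\<close> within the time range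
      \<open>T + 2\<close> on the window and lets \<open>h\<close> pass \<open>T\<close> by its
      end.\<close>
    define \<eta> where "\<eta> = min \<eta>0 1"
    have \<eta>: "\<eta> > 0" "\<eta> \<le> \<eta>0" "\<eta> \<le> 1" using \<eta>0 by (auto simp: \<eta>_def)
    have T1: "T + 1 > 0" using T by simp
    obtain \<delta>2 where \<delta>2: "\<delta>2 > 0"
      "\<And>\<xi> t s. \<lbrakk>pseudotrajectory dist M2 phi2 \<delta>2 \<xi>; s \<in> {0..T + 1}\<rbrakk> \<Longrightarrow> dist (\<xi> (t + s)) (phi2 s (\<xi> t)) < \<epsilon> / 2"
      using F2.pseudotrajectory_near_orbit[OF e, of "T + 1"] by blast
    \<comment> \<open>The window is one unit longer than the transit time \<open>T\<close> because
      \<open>h\<close> may lag by up to \<open>\<eta>\<close>.\<close>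
    obtain \<delta>3 where \<delta>3: "\<delta>3 > 0"
      "\<And>\<xi> a. pseudotrajectory dist M1 phi1 \<delta>3 \<xi> \<Longrightarrow>
         \<exists>x\<in>M1. \<exists>h\<in>Rep. h a = 0 \<and> (\<forall>t\<in>{a..a + (T + 1)}. \<bar>h t - (t - a)\<bar> < \<eta>) \<and>
           (\<forall>t. dist (\<xi> t) (phi1 (h t) x) < \<epsilon>)"
      using F1.shadowing_unit_speed[OF assms(5) \<open>\<epsilon> > 0\<close> \<eta>(1) T1] by blast
    define \<delta> where "\<delta> = min \<delta>1 (min \<delta>2 \<delta>3)"
    have "\<exists>x\<in>M1 \<times> M2. \<exists>h\<in>Rep. \<forall>t. max_dist (\<xi> t) (prod_flow phi1 phi2 (h t) x) < \<epsilon>"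
      if p: "pseudotrajectory max_dist (M1 \<times> M2) (prod_flow phi1 phi2) \<delta> \<xi>" for \<xi>
    proof -
      define \<xi>1 \<xi>2 where "\<xi>1 = (\<lambda>t. fst (\<xi> t))" and "\<xi>2 = (\<lambda>t. snd (\<xi> t))"
      have p1: "pseudotrajectory dist M1 phi1 \<delta>3 \<xi>1"
        unfolding \<xi>1_def
        by (rule F1.pseudotrajectory_mono[OF pseudotrajectory_max_distD(1)[OF p]]) (simp add: \<delta>_def)
      have p2: "pseudotrajectory dist M2 phi2 \<delta>1 \<xi>2" "pseudotrajectory dist M2 phi2 \<delta>2 \<xi>2"
        unfolding \<xi>2_def
        by (rule F2.pseudotrajectory_mono[OF pseudotrajectory_max_distD(2)[OF p]], simp add: \<delta>_def)+
      have "\<exists>x1\<in>M1. \<exists>x2\<in>M2. \<exists>h\<in>Rep. \<forall>t. dist (\<xi>1 t) (phi1 (h t) x1) < \<epsilon> \<and> dist (\<xi>2 t) (phi2 (h t) x2) < \<epsilon>"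
        using T(3)[OF p2(1)]
      proof (elim disjE bexE exE conjE)
        fix q
        assume q: "q \<in> Sing M2 phi2" "\<forall>t. dist q (\<xi>2 t) < \<epsilon> / 2"
        \<comment> \<open>The orbit of a singularity is constant, so any reparametrization from the
          first factor, with any base time, will do.\<close>
        obtain x h where "x \<in> M1" "h \<in> Rep" "\<forall>t. dist (\<xi>1 t) (phi1 (h t) x) < \<epsilon>"
          using \<delta>3(2)[OF p1] by blast
        moreover have "dist (\<xi>2 t) q < \<epsilon>" for t
          using q(2)[rule_format, of t] \<open>\<epsilon> > 0\<close> by (simp add: dist_commute)
        moreover have "q \<in> M2" "phi2 t q = q" for t using q(1) by (auto simp: Sing_def)
        ultimately show ?thesis by metis
      next
        fix a p q
        assume pq: "\<forall>t\<le>a. dist p (\<xi>2 t) < \<epsilon> / 2" "\<forall>t\<ge>a + T. dist q (\<xi>2 t) < \<epsilon> / 2"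
          "\<forall>s\<le>0. dist p (phi2 s (\<xi>2 a)) < \<epsilon> / 2" "\<forall>s\<ge>T. dist q (phi2 s (\<xi>2 a)) < \<epsilon> / 2"
        have z: "\<xi>2 a \<in> M2" using p2 by (simp add: pseudotrajectory_def)
        \<comment> \<open>The base time \<open>a\<close> comes from the second factor, the
          reparametrization from the first.\<close>
        obtain x h where xh: "x \<in> M1" "h \<in> Rep" "h a = 0" "\<And>t. t \<in> {a..a + (T + 1)} \<Longrightarrow> \<bar>h t - (t - a)\<bar> < \<eta>"
          "\<forall>t. dist (\<xi>1 t) (phi1 (h t) x) < \<epsilon>"
          using \<delta>3(2)[OF p1] by blast
        have hmono: "h s \<le> h t" if "s \<le> t" for s t
          using RepD(1)[OF xh(2)] that by (simp add: strict_mono_less_eq)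
        have "dist (\<xi>2 t) (phi2 (h t) (\<xi>2 a)) < \<epsilon>" for t
        proof -
          \<comment> \<open>Before \<open>a\<close>, \<open>h t \<le> 0\<close> and both points are
            near \<open>p\<close>; on the window the two orbit times differ by less than
            \<open>\<eta>\<close>; afterwards \<open>h t \<ge> T\<close> and both points are near
            \<open>q\<close>.\<close>
          consider "t \<le> a" | "t \<in> {a..a + (T + 1)}" | "t \<ge> a + (T + 1)" by fastforce
          then show ?thesis
          proof cases
            case 1
            then have "dist p (\<xi>2 t) < \<epsilon> / 2" "dist p (phi2 (h t) (\<xi>2 a)) < \<epsilon> / 2"
              using pq hmono[of t a] xh(3) by auto
            then show ?thesis by (metis dist_triangle_half_r)
          next
            case 2
            have "dist (\<xi>2 t) (phi2 (t - a) (\<xi>2 a)) < \<epsilon> / 2"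
              using \<delta>2(2)[OF p2(2), of "t - a" a] 2 by simp
            moreover have "dist (phi2 (t - a) (\<xi>2 a)) (phi2 (h t) (\<xi>2 a)) < \<epsilon> / 2"
              using xh(4)[OF 2] \<eta> \<eta>0(1) 2 z by (intro \<eta>0(2)) auto
            ultimately show ?thesis by (metis dist_triangle_half_r dist_commute)
          next
            case 3
            have "T \<le> h (a + (T + 1))" using xh(4)[of "a + (T + 1)"] \<eta>(3) T1 by auto
            then have "T \<le> h t" using hmono[OF 3] by simp
            then have "dist q (\<xi>2 t) < \<epsilon> / 2" "dist q (phi2 (h t) (\<xi>2 a)) < \<epsilon> / 2"
              using pq 3 by auto
            then show ?thesis by (metis dist_triangle_half_r)
          qed
        qed
        then show ?thesis using xh z by blast
      qed
      then obtain x1 x2 h where "x1 \<in> M1" "x2 \<in> M2" "h \<in> Rep"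
        "\<forall>t. dist (\<xi>1 t) (phi1 (h t) x1) < \<epsilon> \<and> dist (\<xi>2 t) (phi2 (h t) x2) < \<epsilon>" by blast
      then show ?thesis
        by (intro bexI[of _ "(x1, x2)"] bexI[of _ h])
          (auto simp: max_dist_def prod_flow_def case_prod_unfold \<xi>1_def \<xi>2_def)
    qed
    moreover have "\<delta> > 0" using T \<delta>2 \<delta>3 by (simp add: \<delta>_def)
    ultimately show "\<exists>\<delta>>0. \<forall>\<xi>. pseudotrajectory max_dist (M1 \<times> M2) (prod_flow phi1 phi2) \<delta> \<xi> \<longrightarrow>
      (\<exists>x\<in>M1 \<times> M2. \<exists>h\<in>Rep. \<forall>t. max_dist (\<xi> t) (prod_flow phi1 phi2 (h t) x) < \<epsilon>)" by blast
  qed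
qed

end
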